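(* Let $G$ be a finite abelian group with a direct decomposition $G=G_1\times G_2$, where $|G_i|=p_i^{\alpha_i}$ for $i=1,2$ and $p_1,p_2$ are distinct primes. Then the number of diamonds in the subgroup lattice of $G$ satisfies $$dm(G)=dm(G_1)\,|L(G_2)|+dm(G_2)\,|L(G_1)|+6\,dm(G_1)\,dm(G_2).$$
   Context: For a finite group $G$, $L(G)$ denotes the lattice of all subgroups of $G$ (meet $A\wedge B=A\cap B$, join $A\vee B=\langle A,B\rangle$), and $|L(G)|$ is the number of subgroups. A diamond of $G$ is a sublattice of $L(G)$ isomorphic to the diamond lattice $M_5$ (the five-element lattice with a bottom, a top and three pairwise incomparable elements, any two of which meet in the bottom and join to the top). Equivalently, a diamond is an unordered triple $\{A,B,C\}$ of three distinct subgroups of $G$ with $A\wedge B=B\wedge C=C\wedge A$ and $A\vee B=B\vee C=C\vee A$. $dm(G)$ denotes the number of diamonds of $G$. *)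

theory Defs
  imports "HOL-Algebra.Algebra"
begin

definition subgroup_lattice :: "('a, 'b) monoid_scheme \<Rightarrow> 'a set gorder" where
  "subgroup_lattice G = \<lparr>carrier = {H. subgroup H G}, eq = (=), le = (\<subseteq>)\<rparr>"

datatype m5 = M5_Bot | M5_A | M5_B | M5_C | M5_Top

definition M5 :: "m5 gorder" where
  "M5 = \<lparr>carrier = UNIV, eq = (=), le = (\<lambda>x y. x = y \<or> x = M5_Bot \<or> y = M5_Top)\<rparr>"

definition sublattice :: "'a set \<Rightarrow> ('a, 'b) gorder_scheme \<Rightarrow> bool" where
  "sublattice S L \<longleftrightarrow> S \<noteq> {} \<and> S \<subseteq> carrier L \<and>
     (\<forall>x\<in>S. \<forall>y\<in>S. x \<sqinter>\<^bsub>L\<^esub> y \<in> S \<and> x \<squnion>\<^bsub>L\<^esub> y \<in> S)"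

text \<open>\<^const>\<open>join_pres\<close> and \<^const>\<open>meet_pres\<close> include the requirement that
  both structures are lattices.\<close>

definition lattice_isomorphic :: "('a, 'c) gorder_scheme \<Rightarrow> ('b, 'd) gorder_scheme \<Rightarrow> bool" where
  "lattice_isomorphic L M \<longleftrightarrow>
     (\<exists>h. bij_betw h (carrier L) (carrier M) \<and> join_pres L M h \<and> meet_pres L M h)"

text \<open>A diamond is represented by the underlying set of a sublattice; it is regarded as a lattice
  in its own right by restricting the carrier.\<close>

definition diamond :: "('a, 'b) monoid_scheme \<Rightarrow> 'a set set \<Rightarrow> bool" where
  "diamond G S \<longleftrightarrow> sublattice S (subgroup_lattice G) \<and>
     lattice_isomorphic (subgroup_lattice G\<lparr>carrier := S\<rparr>) M5"

definition dm :: "('a, 'b) monoid_scheme \<Rightarrow> nat" where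
  "dm G = card {S. diamond G S}"


lemma carrier_subgroup_lattice [simp]: "carrier (subgroup_lattice G) = {H. subgroup H G}"
  by (simp add: subgroup_lattice_def)

lemma (in group) lattice_subgroup_lattice: "lattice (subgroup_lattice G)"
  using subgroups_complete_lattice unfolding subgroup_lattice_def
  by (rule complete_lattice_lattice)

lemma (in group) meet_subgroup_lattice:
  assumes "subgroup A G" "subgroup B G"
  shows "A \<sqinter>\<^bsub>subgroup_lattice G\<^esub> B = A \<inter> B"
proof -
  interpret L: lattice "subgroup_lattice G" by (rule lattice_subgroup_lattice)
  have "greatest (subgroup_lattice G) (A \<inter> B) (Lower (subgroup_lattice G) {A, B})"
    using assms subgroups_Inter_pair [OF assms]
    by (auto simp: greatest_def Lower_def subgroup_lattice_def)
  thus ?thesis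
    by (smt (verit) L.inf_of_two_greatest L.greatest_unique assms carrier_subgroup_lattice
        mem_Collect_eq meet_def)
qed

lemma (in group) join_subgroup_lattice:
  assumes "subgroup A G" "subgroup B G"
  shows "A \<squnion>\<^bsub>subgroup_lattice G\<^esub> B = generate G (A \<union> B)"
proof -
  interpret L: lattice "subgroup_lattice G" by (rule lattice_subgroup_lattice)
  have AB: "A \<union> B \<subseteq> carrier G"
    using assms by (auto dest: subgroup.subset)
  have "least (subgroup_lattice G) (generate G (A \<union> B)) (Upper (subgroup_lattice G) {A, B})"
    using assms generate_is_subgroup [OF AB] generate_subgroup_incl [of "A \<union> B"]
      generate.incl [of _ "A \<union> B" G]
    by (auto simp: least_def Upper_def subgroup_lattice_def)
  thus ?thesis
    by (smt (verit) L.sup_of_two_least L.least_unique assms carrier_subgroup_lattice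
        mem_Collect_eq join_def)
qed

lemma M5_simps [simp]: "carrier M5 = UNIV" "x \<sqsubseteq>\<^bsub>M5\<^esub> y \<longleftrightarrow> x = y \<or> x = M5_Bot \<or> y = M5_Top"
  "x .=\<^bsub>M5\<^esub> y \<longleftrightarrow> x = y"
  by (simp_all add: M5_def)

lemma partial_order_M5: "partial_order M5"
  by unfold_locales (auto simp: M5_def fun_eq_iff)

lemma least_M5:
  "least M5 (if x = y then x else if x = M5_Bot then y else if y = M5_Bot then x else M5_Top)
     (Upper M5 {x, y})"
  by (cases x; cases y) (auto simp: least_def Upper_def)

lemma greatest_M5:
  "greatest M5 (if x = y then x else if x = M5_Top then y else if y = M5_Top then x else M5_Bot)
     (Lower M5 {x, y})"
  by (cases x; cases y) (auto simp: greatest_def Lower_def)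

lemma lattice_M5: "lattice M5"
proof -
  interpret partial_order M5 by (rule partial_order_M5)
  show ?thesis
    by unfold_locales (use least_M5 greatest_M5 in blast)+
qed

lemma join_M5:
  "x \<squnion>\<^bsub>M5\<^esub> y = (if x = y then x else if x = M5_Bot then y else if y = M5_Bot then x else M5_Top)"
proof -
  interpret lattice M5 by (rule lattice_M5)
  show ?thesis
    using least_unique [OF sup_of_two_least [of x y] least_M5 [of x y]] by (simp add: join_def)
qed

lemma meet_M5:
  "x \<sqinter>\<^bsub>M5\<^esub> y = (if x = y then x else if x = M5_Top then y else if y = M5_Top then x else M5_Bot)"
proof -
  interpret lattice M5 by (rule lattice_M5)
  show ?thesis
    using greatest_unique [OF inf_of_two_greatest [of x y] greatest_M5 [of x y]]
    by (simp add: meet_def)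
qed


lemma lattice_sublattice:
  assumes "lattice L" "sublattice S L"
  shows "lattice (L\<lparr>carrier := S\<rparr>)"
    and "x \<in> S \<Longrightarrow> y \<in> S \<Longrightarrow> x \<sqinter>\<^bsub>L\<lparr>carrier := S\<rparr>\<^esub> y = x \<sqinter>\<^bsub>L\<^esub> y"
    and "x \<in> S \<Longrightarrow> y \<in> S \<Longrightarrow> x \<squnion>\<^bsub>L\<lparr>carrier := S\<rparr>\<^esub> y = x \<squnion>\<^bsub>L\<^esub> y"
proof -
  let ?M = "L\<lparr>carrier := S\<rparr>"
  interpret L: lattice L by fact
  have S: "\<And>x. x \<in> S \<Longrightarrow> x \<in> carrier L"
    and meet: "\<And>x y. x \<in> S \<Longrightarrow> y \<in> S \<Longrightarrow> x \<sqinter>\<^bsub>L\<^esub> y \<in> S"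
    and join: "\<And>x y. x \<in> S \<Longrightarrow> y \<in> S \<Longrightarrow> x \<squnion>\<^bsub>L\<^esub> y \<in> S"
    using assms(2) by (auto simp: sublattice_def)
  have po: "partial_order ?M"
    by unfold_locales (auto simp: S L.le_antisym L.eq_is_equal intro: L.le_trans)
  have gr: "greatest ?M (x \<sqinter>\<^bsub>L\<^esub> y) (Lower ?M {x, y})" if "x \<in> S" "y \<in> S" for x y
    using that by (auto simp: greatest_def Lower_def S meet L.meet_left L.meet_right intro!: L.meet_le)
  have le: "least ?M (x \<squnion>\<^bsub>L\<^esub> y) (Upper ?M {x, y})" if "x \<in> S" "y \<in> S" for x y
    using that by (auto simp: least_def Upper_def S join L.join_left L.join_right intro!: L.join_le)
  interpret M: partial_order ?M by fact
  show M: "lattice ?M"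
    by unfold_locales (use gr le in \<open>simp; blast\<close>)+
  interpret M: lattice ?M by fact
  show "x \<sqinter>\<^bsub>?M\<^esub> y = x \<sqinter>\<^bsub>L\<^esub> y" if "x \<in> S" "y \<in> S"
    using M.greatest_unique [OF M.inf_of_two_greatest [of x y] gr] that by (simp add: meet_def)
  show "x \<squnion>\<^bsub>?M\<^esub> y = x \<squnion>\<^bsub>L\<^esub> y" if "x \<in> S" "y \<in> S"
    using M.least_unique [OF M.sup_of_two_least [of x y] le] that by (simp add: join_def)
qed

lemma (in group) diamond_iff:
  "diamond G S \<longleftrightarrow>
     (\<exists>A B C. subgroup A G \<and> subgroup B G \<and> subgroup C G \<and> A \<noteq> B \<and> B \<noteq> C \<and> C \<noteq> A \<and>
        A \<inter> B = B \<inter> C \<and> B \<inter> C = C \<inter> A \<and>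
        generate G (A \<union> B) = generate G (B \<union> C) \<and>
        generate G (B \<union> C) = generate G (C \<union> A) \<and>
        S = {A \<inter> B, A, B, C, generate G (A \<union> B)})" (is "_ \<longleftrightarrow> ?R")
proof
  let ?L = "subgroup_lattice G"
  interpret L: lattice ?L by (rule lattice_subgroup_lattice)
  assume D: "diamond G S"
  then obtain h where sub: "sublattice S ?L" and h: "bij_betw h S UNIV"
    and j: "join_pres (?L\<lparr>carrier := S\<rparr>) M5 h" and m: "meet_pres (?L\<lparr>carrier := S\<rparr>) M5 h"
    by (auto simp: diamond_def lattice_isomorphic_def)
  note ms = lattice_sublattice(2) [OF lattice_subgroup_lattice sub]
    and js = lattice_sublattice(3) [OF lattice_subgroup_lattice sub]
  define g where "g = inv_into S h"
  have g: "g x \<in> S" "h (g x) = x" for x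
    using h by (auto simp: g_def bij_betw_def inv_into_into f_inv_into_f)
  have gh: "x \<in> S \<Longrightarrow> g (h x) = x" for x
    using h by (auto simp: g_def bij_betw_def)
  have sg: "subgroup (g x) G" for x using g(1) [of x] sub by (auto simp: sublattice_def)
  have gm: "g (x \<sqinter>\<^bsub>M5\<^esub> y) = g x \<inter> g y" for x y
  proof -
    have "h (g x \<sqinter>\<^bsub>?L\<^esub> g y) = x \<sqinter>\<^bsub>M5\<^esub> y"
      unfolding ms [OF g(1) g(1), symmetric] using m g by (simp add: meet_pres_def)
    moreover have "g x \<sqinter>\<^bsub>?L\<^esub> g y \<in> S" using g sub by (auto simp: sublattice_def)
    ultimately show ?thesis using gh meet_subgroup_lattice [OF sg sg] by metis
  qed
  have gj: "g (x \<squnion>\<^bsub>M5\<^esub> y) = generate G (g x \<union> g y)" for x y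
  proof -
    have "h (g x \<squnion>\<^bsub>?L\<^esub> g y) = x \<squnion>\<^bsub>M5\<^esub> y"
      unfolding js [OF g(1) g(1), symmetric] using j g by (simp add: join_pres_def)
    moreover have "g x \<squnion>\<^bsub>?L\<^esub> g y \<in> S" using g sub by (auto simp: sublattice_def)
    ultimately show ?thesis using gh join_subgroup_lattice [OF sg sg] by metis
  qed
  have U: "(UNIV :: m5 set) = {M5_Bot, M5_A, M5_B, M5_C, M5_Top}"
    using m5.exhaust by blast
  have "S = g ` UNIV" using g gh by (metis image_subset_iff rangeI subsetI subset_antisym)
  hence S: "S = {g M5_Bot, g M5_A, g M5_B, g M5_C, g M5_Top}" by (simp add: U)
  have ne: "g M5_A \<noteq> g M5_B" "g M5_B \<noteq> g M5_C" "g M5_C \<noteq> g M5_A"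
    using g(2) by (metis m5.distinct)+
  show ?R
    by (rule exI [of _ "g M5_A"], rule exI [of _ "g M5_B"],
        rule exI [of _ "g M5_C"]) (simp add: S ne sg join_M5 meet_M5 flip: gm gj)
next
  let ?L = "subgroup_lattice G"
  interpret L: lattice ?L by (rule lattice_subgroup_lattice)
  assume ?R
  then obtain A B C where sg: "subgroup A G" "subgroup B G" "subgroup C G"
    and ne: "A \<noteq> B" "B \<noteq> C" "C \<noteq> A"
    and I: "A \<inter> B = B \<inter> C" "B \<inter> C = C \<inter> A"
    and J: "generate G (A \<union> B) = generate G (B \<union> C)" "generate G (B \<union> C) = generate G (C \<union> A)"
    and S: "S = {A \<inter> B, A, B, C, generate G (A \<union> B)}"
    by blast
  define N T where "N = A \<inter> B" and "T = generate G (A \<union> B)"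
  define g where "g = (\<lambda>x. case x of M5_Bot \<Rightarrow> N | M5_A \<Rightarrow> A | M5_B \<Rightarrow> B | M5_C \<Rightarrow> C | M5_Top \<Rightarrow> T)"
  have sgN: "subgroup N G" using sg subgroups_Inter_pair by (auto simp: N_def)
  have cU: "P \<union> Q \<subseteq> carrier G" if "subgroup P G" "subgroup Q G" for P Q
    using that by (auto dest: subgroup.subset)
  have sgT: "subgroup T G" using generate_is_subgroup [OF cU] sg by (auto simp: T_def)
  have le: "N \<subseteq> A" "N \<subseteq> B" "N \<subseteq> C" using I by (auto simp: N_def)
  have ge: "A \<subseteq> T" "B \<subseteq> T" "C \<subseteq> T" using J by (auto simp: T_def intro: generate.incl)
  have meets: "A \<inter> B = N" "B \<inter> C = N" "C \<inter> A = N" using I by (auto simp: N_def)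
  have gen: "generate G P = P" if "subgroup P G" for P
    by (rule generateI [OF that, symmetric]) auto
  have joins: "generate G (A \<union> B) = T" "generate G (B \<union> C) = T" "generate G (C \<union> A) = T"
    using J by (auto simp: T_def)
  have nle: "\<not> P \<subseteq> Q" if PQ: "P \<in> {A, B, C}" "Q \<in> {A, B, C}" "P \<noteq> Q" for P Q
  proof
    assume "P \<subseteq> Q"
    have mt: "P' \<inter> Q' = N" if "P' \<in> {A, B, C}" "Q' \<in> {A, B, C}" "P' \<noteq> Q'" for P' Q'
      using that meets by (auto simp: Int_commute)
    have "generate G (P \<union> Q) = T"
      using PQ joins by (elim insertE emptyE) (simp_all add: Un_commute)
    moreover have "P \<union> Q = Q" using \<open>P \<subseteq> Q\<close> by blast
    moreover have "generate G Q = Q" using PQ(2) gen sg by auto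
    ultimately have "Q = T" by simp
    obtain R where R: "R \<in> {A, B, C}" "R \<noteq> P" "R \<noteq> Q" using PQ ne by blast
    have "R \<subseteq> T" using R(1) ge by auto
    then have "R = N" using mt [OF R(1) PQ(2) R(3)] \<open>Q = T\<close> by blast
    moreover have "P = N" using mt [OF PQ] \<open>P \<subseteq> Q\<close> by blast
    ultimately show False using R(2) by simp
  qed
  have sgg: "subgroup (g x) G" for x using sg sgN sgT by (cases x) (auto simp: g_def)
  have gle: "g x \<subseteq> g y \<longleftrightarrow> x \<sqsubseteq>\<^bsub>M5\<^esub> y" for x y
  proof -
    have AB: "\<not> A \<subseteq> B" "\<not> B \<subseteq> A" "\<not> A \<subseteq> C" "\<not> C \<subseteq> A" "\<not> B \<subseteq> C" "\<not> C \<subseteq> B"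
      by (rule nle; use ne in simp)+
    have N: "\<not> A \<subseteq> N" "\<not> B \<subseteq> N" "\<not> C \<subseteq> N" using AB le by blast+
    have T: "\<not> T \<subseteq> A" "\<not> T \<subseteq> B" "\<not> T \<subseteq> C" using AB ge by blast+
    have "\<not> T \<subseteq> N" "N \<subseteq> T" using N ge le by blast+
    with AB N T le ge show ?thesis
      by (cases x; cases y) (simp_all add: g_def)
  qed
  have inj: "inj g"
  proof (rule injI)
    fix x y assume "g x = g y"
    then have "x \<sqsubseteq>\<^bsub>M5\<^esub> y" "y \<sqsubseteq>\<^bsub>M5\<^esub> x" using gle by blast+
    then show "x = y" by (auto)
  qed
  have gm: "g x \<inter> g y = g (x \<sqinter>\<^bsub>M5\<^esub> y)" for x y
    using meets le ge by (cases x; cases y) (auto simp: g_def meet_M5)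
  have gj: "generate G (g x \<union> g y) = g (x \<squnion>\<^bsub>M5\<^esub> y)" for x y
  proof -
    have c: "P \<subseteq> Q \<Longrightarrow> subgroup Q G \<Longrightarrow> generate G (P \<union> Q) = Q \<and> generate G (Q \<union> P) = Q" for P Q
      using gen by (simp add: Un_absorb1 Un_absorb2)
    have "N \<subseteq> T" using le ge by blast
    with c [OF le(1)] c [OF le(2)] c [OF le(3)] c [OF ge(1)] c [OF ge(2)] c [OF ge(3)] c [of N T]
      joins joins [unfolded Un_commute [of A B] Un_commute [of B C] Un_commute [of C A]]
    show ?thesis
      by (cases x; cases y) (simp_all add: g_def join_M5 sg sgT gen sgN)
  qed
  have U: "(UNIV :: m5 set) = {M5_Bot, M5_A, M5_B, M5_C, M5_Top}"
    using m5.exhaust by blast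
  have Sg: "S = g ` UNIV" unfolding S U by (simp add: g_def N_def T_def)
  have sub: "sublattice S ?L"
    unfolding sublattice_def Sg
    by (auto simp: sgg meet_subgroup_lattice join_subgroup_lattice gm gj)
  note ms = lattice_sublattice(2) [OF lattice_subgroup_lattice sub]
    and js = lattice_sublattice(3) [OF lattice_subgroup_lattice sub]
    and ls = lattice_sublattice(1) [OF lattice_subgroup_lattice sub]
  have "bij_betw (inv_into UNIV g) S UNIV"
    unfolding Sg using inj by (simp add: bij_betw_inv_into inj_imp_bij_betw_inv)
  moreover have "join_pres (?L\<lparr>carrier := S\<rparr>) M5 (inv_into UNIV g)"
    using ls lattice_M5 js
    by (auto simp: join_pres_def Sg join_subgroup_lattice sgg gj inv_f_f [OF inj])
  moreover have "meet_pres (?L\<lparr>carrier := S\<rparr>) M5 (inv_into UNIV g)"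
    using ls lattice_M5 ms
    by (auto simp: meet_pres_def Sg meet_subgroup_lattice sgg gm inv_f_f [OF inj])
  ultimately show "diamond G S"
    using sub by (auto simp: diamond_def lattice_isomorphic_def)
qed

end

theory Submission
  imports Defs "HOL-Number_Theory.Cong"
begin

text \<open>Call an ordered triple of subgroups balanced if its pairwise meets coincide and its pairwise joins
  coincide. If two members of a balanced triple are equal, then so are all three; hence there are
  \<open>6 dm(G) + |L(G)|\<close> balanced triples. Since the orders are coprime, \<open>L(G)\<close> is the product
  lattice \<open>L(G\<^sub>1) \<times> L(G\<^sub>2)\<close>, so the number of balanced triples is multiplicative, and the
  formula follows by expanding the product and dividing by 6.\<close>

text \<open>Meets and joins are encoded by lower and upper bounds within the family, so that being
  balanced is visibly invariant under order isomorphisms.\<close>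

definition balanced :: "'a set set \<Rightarrow> ('a set \<times> 'a set \<times> 'a set) set" where
  "balanced L = {(A, B, C). A \<in> L \<and> B \<in> L \<and> C \<in> L \<and>
     (\<forall>U\<in>L. (U \<subseteq> A \<and> U \<subseteq> B \<longleftrightarrow> U \<subseteq> B \<and> U \<subseteq> C) \<and> (U \<subseteq> B \<and> U \<subseteq> C \<longleftrightarrow> U \<subseteq> C \<and> U \<subseteq> A) \<and>
            (A \<subseteq> U \<and> B \<subseteq> U \<longleftrightarrow> B \<subseteq> U \<and> C \<subseteq> U) \<and> (B \<subseteq> U \<and> C \<subseteq> U \<longleftrightarrow> C \<subseteq> U \<and> A \<subseteq> U))}"

section \<open>Balanced triples in a product order\<close>

text \<open>By \<open>le\<close>, \<open>f\<close> is an isomorphism from the componentwise order,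
  so a bound in \<open>L\<close> is a pair of bounds. The least and greatest members let one
  coordinate be tested while the other imposes no condition.\<close>

lemma card_balanced_product:
  assumes f: "bij_betw f (L1 \<times> L2) L"
    and le: "\<And>A B A' B'. A \<in> L1 \<Longrightarrow> A' \<in> L1 \<Longrightarrow> B \<in> L2 \<Longrightarrow> B' \<in> L2 \<Longrightarrow>
               f (A, B) \<subseteq> f (A', B') \<longleftrightarrow> A \<subseteq> A' \<and> B \<subseteq> B'"
    and bot: "N1 \<in> L1" "\<And>A. A \<in> L1 \<Longrightarrow> N1 \<subseteq> A" "N2 \<in> L2" "\<And>A. A \<in> L2 \<Longrightarrow> N2 \<subseteq> A"
    and top: "T1 \<in> L1" "\<And>A. A \<in> L1 \<Longrightarrow> A \<subseteq> T1" "T2 \<in> L2" "\<And>A. A \<in> L2 \<Longrightarrow> A \<subseteq> T2"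
  shows "card (balanced L) = card (balanced L1) * card (balanced L2)"
proof -
  \<comment> \<open>Transposes a pair of triples into a triple of pairs, then applies
    \<open>f\<close> entrywise.\<close>
  define F where "F = (\<lambda>((A1, B1, C1), (A2, B2, C2)). (f (A1, A2), f (B1, B2), f (C1, C2)))"
  have L: "L = f ` (L1 \<times> L2)" and inj: "inj_on f (L1 \<times> L2)"
    using f by (auto simp: bij_betw_def)
  have bal: "(f (A1, A2), f (B1, B2), f (C1, C2)) \<in> balanced L \<longleftrightarrow>
      (A1, B1, C1) \<in> balanced L1 \<and> (A2, B2, C2) \<in> balanced L2" (is "?l \<longleftrightarrow> ?r")
    if m: "A1 \<in> L1" "B1 \<in> L1" "C1 \<in> L1" "A2 \<in> L2" "B2 \<in> L2" "C2 \<in> L2"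
    for A1 B1 C1 A2 B2 C2
  proof
    assume ?l
    then have u: "\<forall>U1\<in>L1. \<forall>U2\<in>L2. let U = f (U1, U2); A = f (A1, A2); B = f (B1, B2); C = f (C1, C2) in
        (U \<subseteq> A \<and> U \<subseteq> B \<longleftrightarrow> U \<subseteq> B \<and> U \<subseteq> C) \<and> (U \<subseteq> B \<and> U \<subseteq> C \<longleftrightarrow> U \<subseteq> C \<and> U \<subseteq> A) \<and>
        (A \<subseteq> U \<and> B \<subseteq> U \<longleftrightarrow> B \<subseteq> U \<and> C \<subseteq> U) \<and> (B \<subseteq> U \<and> C \<subseteq> U \<longleftrightarrow> C \<subseteq> U \<and> A \<subseteq> U)"
      by (simp add: balanced_def L Let_def)
    \<comment> \<open>With \<open>U2 = N2\<close> every lower-bound condition in the second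
      coordinate is true, and with \<open>U2 = T2\<close> every upper-bound condition is. What
      remains are the conditions on \<open>U1\<close>. The second coordinate is treated
      symmetrically.\<close>
    have "(A1, B1, C1) \<in> balanced L1"
      using bspec [OF bspec [OF u] bot(3)] bspec [OF bspec [OF u] top(3)]
      by (auto simp: balanced_def Let_def le m bot top)
    moreover have "(A2, B2, C2) \<in> balanced L2"
      using bspec [OF bspec [OF u bot(1)]] bspec [OF bspec [OF u top(1)]]
      by (auto simp: balanced_def Let_def le m bot top)
    ultimately show ?r ..
  next
    assume r: ?r
    have "let U = f (U1, U2); A = f (A1, A2); B = f (B1, B2); C = f (C1, C2) in
        (U \<subseteq> A \<and> U \<subseteq> B \<longleftrightarrow> U \<subseteq> B \<and> U \<subseteq> C) \<and> (U \<subseteq> B \<and> U \<subseteq> C \<longleftrightarrow> U \<subseteq> C \<and> U \<subseteq> A) \<and>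
        (A \<subseteq> U \<and> B \<subseteq> U \<longleftrightarrow> B \<subseteq> U \<and> C \<subseteq> U) \<and> (B \<subseteq> U \<and> C \<subseteq> U \<longleftrightarrow> C \<subseteq> U \<and> A \<subseteq> U)"
      if U: "U1 \<in> L1" "U2 \<in> L2" for U1 U2
    proof -
      \<comment> \<open>Once \<open>le\<close> splits each inclusion into its two coordinates, the
        goal follows propositionally by conjoining these equivalences.\<close>
      have "(U1 \<subseteq> A1 \<and> U1 \<subseteq> B1) = (U1 \<subseteq> B1 \<and> U1 \<subseteq> C1)" "(U1 \<subseteq> B1 \<and> U1 \<subseteq> C1) = (U1 \<subseteq> C1 \<and> U1 \<subseteq> A1)"
          "(A1 \<subseteq> U1 \<and> B1 \<subseteq> U1) = (B1 \<subseteq> U1 \<and> C1 \<subseteq> U1)" "(B1 \<subseteq> U1 \<and> C1 \<subseteq> U1) = (C1 \<subseteq> U1 \<and> A1 \<subseteq> U1)"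
          "(U2 \<subseteq> A2 \<and> U2 \<subseteq> B2) = (U2 \<subseteq> B2 \<and> U2 \<subseteq> C2)" "(U2 \<subseteq> B2 \<and> U2 \<subseteq> C2) = (U2 \<subseteq> C2 \<and> U2 \<subseteq> A2)"
          "(A2 \<subseteq> U2 \<and> B2 \<subseteq> U2) = (B2 \<subseteq> U2 \<and> C2 \<subseteq> U2)" "(B2 \<subseteq> U2 \<and> C2 \<subseteq> U2) = (C2 \<subseteq> U2 \<and> A2 \<subseteq> U2)"
        using r U unfolding balanced_def by simp_all
      then show ?thesis
        unfolding Let_def le [OF U(1) m(1) U(2) m(4)] le [OF U(1) m(2) U(2) m(5)]
          le [OF U(1) m(3) U(2) m(6)] le [OF m(1) U(1) m(4) U(2)] le [OF m(2) U(1) m(5) U(2)]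
          le [OF m(3) U(1) m(6) U(2)]
        by argo
    qed
    then show ?l
      using m by (simp add: balanced_def L Let_def)
  qed
  have "bij_betw F (balanced L1 \<times> balanced L2) (balanced L)"
    unfolding bij_betw_def
  proof
    show "inj_on F (balanced L1 \<times> balanced L2)"
      using inj by (auto simp: inj_on_def F_def balanced_def)
    show "F ` (balanced L1 \<times> balanced L2) = balanced L"
    proof
      show "F ` (balanced L1 \<times> balanced L2) \<subseteq> balanced L"
      proof (rule image_subsetI, clarify)
        fix A1 B1 C1 A2 B2 C2
        assume b: "(A1, B1, C1) \<in> balanced L1" "(A2, B2, C2) \<in> balanced L2"
        then have "A1 \<in> L1" "B1 \<in> L1" "C1 \<in> L1" "A2 \<in> L2" "B2 \<in> L2" "C2 \<in> L2"
          by (auto simp: balanced_def)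
        from bal [OF this] b show "F ((A1, B1, C1), (A2, B2, C2)) \<in> balanced L"
          by (simp add: F_def)
      qed
      show "balanced L \<subseteq> F ` (balanced L1 \<times> balanced L2)"
      proof clarify
        fix A B C
        assume b: "(A, B, C) \<in> balanced L"
        then have "A \<in> L" "B \<in> L" "C \<in> L" by (auto simp: balanced_def)
        then obtain A1 B1 C1 A2 B2 C2 where m: "A1 \<in> L1" "B1 \<in> L1" "C1 \<in> L1" "A2 \<in> L2" "B2 \<in> L2"
            "C2 \<in> L2" and e: "A = f (A1, A2)" "B = f (B1, B2)" "C = f (C1, C2)"
          unfolding L by blast
        have "((A1, B1, C1), (A2, B2, C2)) \<in> balanced L1 \<times> balanced L2"
          using b bal [OF m] by (simp add: e)
        then show "(A, B, C) \<in> F ` (balanced L1 \<times> balanced L2)"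
          by (rule rev_image_eqI) (simp add: F_def e)
      qed
    qed
  qed
  from bij_betw_same_card [OF this] show ?thesis
    by (simp add: card_cartesian_product)
qed

section \<open>Balanced triples of subgroups and diamonds\<close>

text \<open>A subgroup contains a join exactly when it contains both parts, so a join is determined
  by the subgroups above it. For the converse direction, \<open>U\<close> is taken to be each of the
  two joins.\<close>

lemma (in group) generate_Un_eq_iff:
  assumes "A \<subseteq> carrier G" "B \<subseteq> carrier G" "C \<subseteq> carrier G" "D \<subseteq> carrier G"
  shows "generate G (A \<union> B) = generate G (C \<union> D) \<longleftrightarrow>
           (\<forall>U. subgroup U G \<longrightarrow> (A \<subseteq> U \<and> B \<subseteq> U \<longleftrightarrow> C \<subseteq> U \<and> D \<subseteq> U))"
proof -
  have gen: "generate G (P \<union> Q) \<subseteq> U \<longleftrightarrow> P \<subseteq> U \<and> Q \<subseteq> U" if "subgroup U G" for P Q U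
    using generate_subgroup_incl [of "P \<union> Q" U] that generate.incl [of _ "P \<union> Q" G] by blast
  have sg: "subgroup (generate G (A \<union> B)) G" "subgroup (generate G (C \<union> D)) G"
    using assms by (auto intro: generate_is_subgroup)
  show ?thesis
  proof
    assume "generate G (A \<union> B) = generate G (C \<union> D)"
    then show "\<forall>U. subgroup U G \<longrightarrow> (A \<subseteq> U \<and> B \<subseteq> U \<longleftrightarrow> C \<subseteq> U \<and> D \<subseteq> U)"
      by (simp flip: gen)
  next
    assume "\<forall>U. subgroup U G \<longrightarrow> (A \<subseteq> U \<and> B \<subseteq> U \<longleftrightarrow> C \<subseteq> U \<and> D \<subseteq> U)"
    then have "generate G (A \<union> B) \<subseteq> U \<longleftrightarrow> generate G (C \<union> D) \<subseteq> U" if "subgroup U G" for U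
      using that by (simp add: gen)
    from this [OF sg(1)] this [OF sg(2)] show "generate G (A \<union> B) = generate G (C \<union> D)"
      by blast
  qed
qed

text \<open>The dual criterion for meets; here the two intersections, themselves subgroups, serve as
  test elements.\<close>

lemma (in group) Int_eq_iff_lower:
  assumes "subgroup A G" "subgroup B G" "subgroup C G" "subgroup D G"
  shows "A \<inter> B = C \<inter> D \<longleftrightarrow>
           (\<forall>U. subgroup U G \<longrightarrow> (U \<subseteq> A \<and> U \<subseteq> B \<longleftrightarrow> U \<subseteq> C \<and> U \<subseteq> D))"
proof
  assume "A \<inter> B = C \<inter> D"
  then show "\<forall>U. subgroup U G \<longrightarrow> (U \<subseteq> A \<and> U \<subseteq> B \<longleftrightarrow> U \<subseteq> C \<and> U \<subseteq> D)"
    unfolding Int_subset_iff [symmetric] by simp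
next
  assume "\<forall>U. subgroup U G \<longrightarrow> (U \<subseteq> A \<and> U \<subseteq> B \<longleftrightarrow> U \<subseteq> C \<and> U \<subseteq> D)"
  then have "U \<subseteq> A \<inter> B \<longleftrightarrow> U \<subseteq> C \<inter> D" if "subgroup U G" for U
    using that by simp
  from this [OF subgroups_Inter_pair [OF assms(1,2)]] this [OF subgroups_Inter_pair [OF assms(3,4)]]
  show "A \<inter> B = C \<inter> D" by blast
qed

text \<open>Turns the encoding by bounds back into the meets and joins that occur in
  \<open>diamond_iff\<close>.\<close>

lemma (in group) balanced_subgroups_iff:
  "(A, B, C) \<in> balanced {H. subgroup H G} \<longleftrightarrow>
     subgroup A G \<and> subgroup B G \<and> subgroup C G \<and>
     A \<inter> B = B \<inter> C \<and> B \<inter> C = C \<inter> A \<and>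
     generate G (A \<union> B) = generate G (B \<union> C) \<and> generate G (B \<union> C) = generate G (C \<union> A)"
proof (cases "subgroup A G \<and> subgroup B G \<and> subgroup C G")
  case True
  then have "A \<subseteq> carrier G" "B \<subseteq> carrier G" "C \<subseteq> carrier G" by (auto dest: subgroup.subset)
  with True show ?thesis
    by (simp add: balanced_def generate_Un_eq_iff Int_eq_iff_lower imp_conjR all_conj_distrib conj_ac)
qed (auto simp: balanced_def)

text \<open>One inclusion spreads to all six. If \<open>A \<subseteq> B\<close>, then
  \<open>A\<close> is a lower bound of \<open>A\<close> and \<open>B\<close>, hence also of
  \<open>C\<close>; and \<open>B\<close> is an upper bound of \<open>A\<close> and \<open>B\<close>,
  hence also of \<open>C\<close>. Testing with \<open>U\<close> equal to \<open>A\<close>,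
  \<open>B\<close> and \<open>C\<close> yields all such implications.\<close>

lemma balanced_comparable_imp_eq:
  assumes "(A, B, C) \<in> balanced L"
    and "A \<subseteq> B \<or> B \<subseteq> A \<or> A \<subseteq> C \<or> C \<subseteq> A \<or> B \<subseteq> C \<or> C \<subseteq> B"
  shows "A = B \<and> B = C"
proof -
  have m: "A \<in> L" "B \<in> L" "C \<in> L"
    and bounds: "\<And>U. U \<in> L \<Longrightarrow>
      (U \<subseteq> A \<and> U \<subseteq> B \<longleftrightarrow> U \<subseteq> B \<and> U \<subseteq> C) \<and> (U \<subseteq> B \<and> U \<subseteq> C \<longleftrightarrow> U \<subseteq> C \<and> U \<subseteq> A) \<and>
      (A \<subseteq> U \<and> B \<subseteq> U \<longleftrightarrow> B \<subseteq> U \<and> C \<subseteq> U) \<and> (B \<subseteq> U \<and> C \<subseteq> U \<longleftrightarrow> C \<subseteq> U \<and> A \<subseteq> U)"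
    using assms(1) by (simp_all add: balanced_def)
  have "A \<subseteq> B \<longleftrightarrow> A \<subseteq> C" "B \<subseteq> A \<longleftrightarrow> C \<subseteq> A"
    using bounds [OF m(1)] subset_refl [of A] by argo+
  moreover have "B \<subseteq> A \<longleftrightarrow> B \<subseteq> C" "A \<subseteq> B \<longleftrightarrow> C \<subseteq> B"
    using bounds [OF m(2)] subset_refl [of B] by argo+
  moreover have "C \<subseteq> A \<longleftrightarrow> C \<subseteq> B" "A \<subseteq> C \<longleftrightarrow> B \<subseteq> C"
    using bounds [OF m(3)] subset_refl [of C] by argo+
  ultimately have "A \<subseteq> B \<and> B \<subseteq> A \<and> B \<subseteq> C \<and> C \<subseteq> B"
    using assms(2) by argo
  then show ?thesis by blast
qed

lemma (in group) finite_subgroups: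
  assumes "finite (carrier G)"
  shows "finite {H. subgroup H G}"
  by (rule finite_subset [of _ "Pow (carrier G)"]) (use assms in \<open>auto dest: subgroup.subset\<close>)

text \<open>The constant triples contribute the number of subgroups. The remaining ones have
  distinct entries and are counted along the map to diamonds, whose fibres consist of the six
  orderings of the three atoms.\<close>

lemma (in group) card_balanced_subgroups:
  assumes fin: "finite (carrier G)"
  shows "card (balanced {H. subgroup H G}) = 6 * dm G + card {H. subgroup H G}"
proof -
  define L where "L = {H. subgroup H G}"
  define D where "D = {(A, B, C). (A, B, C) \<in> balanced L \<and> A \<noteq> B \<and> B \<noteq> C \<and> C \<noteq> A}"
  \<comment> \<open>Forgets the order of a triple and adds the bottom and the top, giving the
    underlying set of a diamond.\<close>
  define F where "F = (\<lambda>(A, B, C). {A \<inter> B, A, B, C, generate G (A \<union> B)})"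
  have bal: "balanced L = D \<union> (\<lambda>A. (A, A, A)) ` L"
  proof
    show "balanced L \<subseteq> D \<union> (\<lambda>A. (A, A, A)) ` L"
    proof clarify
      fix A B C
      assume b: "(A, B, C) \<in> balanced L" and "(A, B, C) \<notin> (\<lambda>A. (A, A, A)) ` L"
      moreover have "A \<in> L" using b by (simp add: balanced_def)
      ultimately have "\<not> (A = B \<and> B = C)" by blast
      with balanced_comparable_imp_eq [OF b] have "A \<noteq> B" "B \<noteq> C" "C \<noteq> A" by blast+
      with b show "(A, B, C) \<in> D" by (simp add: D_def)
    qed
    show "D \<union> (\<lambda>A. (A, A, A)) ` L \<subseteq> balanced L"
      by (auto simp: D_def) (simp add: balanced_def)
  qed
  have finL: "finite L" unfolding L_def using fin by (rule finite_subgroups)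
  have finD: "finite D"
    by (rule finite_subset [of _ "L \<times> L \<times> L"]) (auto simp: D_def balanced_def finL)
  have dia: "{S. diamond G S} = F ` D"
  proof (rule Set.set_eqI)
    fix S
    have "S \<in> F ` D \<longleftrightarrow> (\<exists>A B C. (A, B, C) \<in> D \<and> S = F (A, B, C))" by force
    also have "\<dots> \<longleftrightarrow> diamond G S"
      unfolding diamond_iff by (simp add: D_def F_def L_def balanced_subgroups_iff conj_ac)
    finally show "S \<in> {S. diamond G S} \<longleftrightarrow> S \<in> F ` D" by simp
  qed
  \<comment> \<open>The atoms of a diamond are recovered by discarding its least and greatest elements.\<close>
  have atoms: "F (A, B, C) - {\<Inter>(F (A, B, C)), \<Union>(F (A, B, C))} = {A, B, C}"
    if "(A, B, C) \<in> D" for A B C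
  proof -
    define N T where "N = A \<inter> B" and "T = generate G (A \<union> B)"
    have b: "(A, B, C) \<in> balanced L" and ne: "A \<noteq> B" "B \<noteq> C" "C \<noteq> A"
      using that by (auto simp: D_def)
    have meets: "A \<inter> B = N" "B \<inter> C = N" "C \<inter> A = N"
      and joins: "generate G (A \<union> B) = T" "generate G (B \<union> C) = T" "generate G (C \<union> A) = T"
      using b by (auto simp: L_def balanced_subgroups_iff N_def T_def)
    have "A \<subseteq> generate G (A \<union> B)" "B \<subseteq> generate G (B \<union> C)" "C \<subseteq> generate G (C \<union> A)"
        "A \<inter> B \<subseteq> A" "B \<inter> C \<subseteq> B" "C \<inter> A \<subseteq> C"
      by (auto intro: generate.incl)
    then have sub: "A \<subseteq> T" "B \<subseteq> T" "C \<subseteq> T" "N \<subseteq> A" "N \<subseteq> B" "N \<subseteq> C"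
      by (simp_all only: meets joins)
    \<comment> \<open>An inclusion between two entries would force \<open>A = B\<close>.
      Incomparability then keeps \<open>N\<close> and \<open>T\<close> apart from the three
      atoms.\<close>
    have nle: "\<not> A \<subseteq> B" "\<not> B \<subseteq> A" "\<not> A \<subseteq> C" "\<not> C \<subseteq> A" "\<not> B \<subseteq> C" "\<not> C \<subseteq> B"
      using ne(1) balanced_comparable_imp_eq [OF b] by argo+
    have F: "F (A, B, C) = {N, A, B, C, T}" by (simp add: F_def N_def T_def)
    \<comment> \<open>Set intersection and union suffice here, because \<open>N\<close> and
      \<open>T\<close> are themselves the least and the greatest member of the family.\<close>
    have "\<Inter>(F (A, B, C)) = N" "\<Union>(F (A, B, C)) = T" using sub by (auto simp: F)
    moreover have "N \<noteq> A" "N \<noteq> B" "N \<noteq> C" "T \<noteq> A" "T \<noteq> B" "T \<noteq> C"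
      using sub nle by blast+
    ultimately show ?thesis by (auto simp: F)
  qed
  have fibre: "card {t \<in> D. F t = S} = 6" if SF: "S \<in> F ` D" for S
  proof -
    obtain t where t: "t \<in> D" "S = F t" using SF by blast
    obtain A B C where "t = (A, B, C)" by (rule prod_cases3)
    with t have d: "(A, B, C) \<in> D" and S: "S = F (A, B, C)" by simp_all
    have ne: "A \<noteq> B" "B \<noteq> C" "C \<noteq> A" using d by (auto simp: D_def)
    define N T where "N = A \<inter> B" and "T = generate G (A \<union> B)"
    have sg: "subgroup A G" "subgroup B G" "subgroup C G"
      and m: "A \<inter> B = N" "B \<inter> C = N" "C \<inter> A = N"
      and j: "generate G (A \<union> B) = T" "generate G (B \<union> C) = T" "generate G (C \<union> A) = T"
      using d by (auto simp: D_def L_def balanced_subgroups_iff N_def T_def)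
    have m': "B \<inter> A = N" "C \<inter> B = N" "A \<inter> C = N"
      using m by (simp_all only: Int_commute)
    have j': "generate G (B \<union> A) = T" "generate G (C \<union> B) = T" "generate G (A \<union> C) = T"
      using j by (simp_all only: Un_commute)
    let ?P = "{(A, B, C), (A, C, B), (B, A, C), (B, C, A), (C, A, B), (C, B, A)}"
    have "{t \<in> D. F t = S} = ?P"
    proof
      show "{t \<in> D. F t = S} \<subseteq> ?P"
      proof
        fix t assume "t \<in> {t \<in> D. F t = S}"
        moreover obtain A' B' C' where t: "t = (A', B', C')" by (rule prod_cases3)
        ultimately have d': "(A', B', C') \<in> D" and e: "S = F (A', B', C')" by simp_all
        \<comment> \<open>Both triples have the same image \<open>S\<close>, and
          \<open>atoms\<close> reads the set of entries off from \<open>S\<close>. Distinctness then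
          leaves only the six permutations.\<close>
        have "{A', B', C'} = {A, B, C}"
          using atoms [OF d] atoms [OF d'] e S by simp
        moreover have "A' \<noteq> B'" "B' \<noteq> C'" "C' \<noteq> A'" using d' by (auto simp: D_def)
        moreover have "A' \<in> {A, B, C}" "B' \<in> {A, B, C}" "C' \<in> {A, B, C}" using calculation(1) by blast+
        ultimately show "t \<in> ?P"
          unfolding t by (elim insertE emptyE; simp)
      qed
      \<comment> \<open>Conversely, the conditions and the value of \<open>F\<close> are symmetric
        in the three entries; \<open>m'\<close> and \<open>j'\<close> supply the swapped meets and
        joins.\<close>
      have "t \<in> D \<and> F t = S" if "t \<in> ?P" for t
        using that ne ne [symmetric]
        by (elim insertE emptyE)
          (simp_all add: S D_def L_def F_def balanced_subgroups_iff sg m m' j j' insert_commute)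
      then show "?P \<subseteq> {t \<in> D. F t = S}"
        by blast
    qed
    \<comment> \<open>The six listed triples are pairwise different since \<open>A\<close>,
      \<open>B\<close>, \<open>C\<close> are.\<close>
    then show ?thesis using ne by (simp add: eq_commute)
  qed
  have "card D = (\<Sum>S\<in>F ` D. card {t \<in> D. F t = S})"
    using sum.image_gen [OF finD, of "\<lambda>_. 1::nat" F] by simp
  also have "\<dots> = 6 * dm G"
    by (simp add: fibre dm_def dia)
  finally have "card D = 6 * dm G" .
  moreover have "card ((\<lambda>A. (A, A, A)) ` L) = card L"
    by (rule card_image) (auto simp: inj_on_def)
  moreover have "D \<inter> (\<lambda>A. (A, A, A)) ` L = {}" by (auto simp: D_def)
  ultimately show ?thesis
    unfolding L_def [symmetric] bal using finD finL by (simp add: card_Un_disjoint)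
qed

section \<open>Subgroups of a direct product of coprime orders\<close>

text \<open>Division with remainder and \<open>a [^] order G = \<one>\<close>. For an infinite
  carrier \<open>order G\<close> is 0, and \<open>n mod 0\<close> is \<open>n\<close>.\<close>

lemma (in group) nat_pow_mod_order:
  assumes "a \<in> carrier G"
  shows "a [^] (n mod order G) = a [^] n"
proof -
  have "a [^] n = a [^] (order G * (n div order G) + n mod order G)" by simp
  also have "\<dots> = (a [^] order G) [^] (n div order G) \<otimes> a [^] (n mod order G)"
    using assms by (simp only: nat_pow_mult nat_pow_pow nat_pow_closed)
  also have "\<dots> = a [^] (n mod order G)"
    using assms by (simp add: pow_order_eq_1)
  finally show ?thesis by simp
qed

lemma (in group) subgroup_nat_pow_closed:
  assumes "subgroup H G" "a \<in> H"
  shows "a [^] (n::nat) \<in> H"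
  using subgroup_int_pow_closed [OF assms, of "int n"] by (simp add: int_pow_int)

lemma nat_pow_DirProd: "(a, b) [^]\<^bsub>G \<times>\<times> H\<^esub> (n::nat) = (a [^]\<^bsub>G\<^esub> n, b [^]\<^bsub>H\<^esub> n)"
  by (induction n) (simp_all add: nat_pow_def DirProd_def)

text \<open>Suitable powers kill one coordinate and preserve the other. Thus \<open>K\<close>
  contains \<open>(a, \<one>)\<close> and \<open>(\<one>, b')\<close> whenever it contains
  \<open>(a, b)\<close> and \<open>(a', b')\<close>, hence also their product
  \<open>(a, b')\<close>.\<close>

lemma subgroup_DirProd_coprime:
  assumes "group G" "group H" and cop: "coprime (order G) (order H)"
    and K: "subgroup K (G \<times>\<times> H)"
  shows "K = fst ` K \<times> snd ` K"
proof
  interpret G: group G by fact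
  interpret H: group H by fact
  interpret P: group "G \<times>\<times> H" by (rule DirProd_group) fact+
  have KG: "a \<in> carrier G" "b \<in> carrier H" if "(a, b) \<in> K" for a b
    using subgroup.subset [OF K] that by (auto simp: DirProd_def)
  have pow: "(a [^]\<^bsub>G\<^esub> (n mod order G), b [^]\<^bsub>H\<^esub> (n mod order H)) \<in> K"
    if "(a, b) \<in> K" for a b n
    using P.subgroup_nat_pow_closed [OF K that, of n] KG [OF that]
    by (simp add: nat_pow_DirProd G.nat_pow_mod_order H.nat_pow_mod_order)
  \<comment> \<open>Raise to powers that are 1 modulo one order and 0 modulo the other.\<close>
  obtain m n :: nat
    where m: "m mod order G = 1 mod order G" "m mod order H = 0 mod order H"
      and n: "n mod order G = 0 mod order G" "n mod order H = 1 mod order H"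
    using binary_chinese_remainder_nat [OF cop] unfolding cong_def by metis
  show "fst ` K \<times> snd ` K \<subseteq> K"
  proof clarsimp
    fix a b a' b'
    assume ab: "(a, b) \<in> K" "(a', b') \<in> K"
    \<comment> \<open>The exponents appear as \<open>1 mod order G\<close> and
      \<open>0 mod order H\<close>; \<open>nat_pow_mod_order\<close> removes the reductions, also
      for order 1, where \<open>1 mod 1\<close> is 0.\<close>
    have "(a, \<one>\<^bsub>H\<^esub>) \<in> K"
      using pow [OF ab(1), of m] KG [OF ab(1)]
      unfolding m by (simp only: G.nat_pow_mod_order H.nat_pow_mod_order G.nat_pow_0 H.nat_pow_0 G.nat_pow_eone H.nat_pow_eone)
    moreover have "(\<one>\<^bsub>G\<^esub>, b') \<in> K"
      using pow [OF ab(2), of n] KG [OF ab(2)]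
      unfolding n by (simp only: G.nat_pow_mod_order H.nat_pow_mod_order G.nat_pow_0 H.nat_pow_0 G.nat_pow_eone H.nat_pow_eone)
    ultimately have "(a, \<one>\<^bsub>H\<^esub>) \<otimes>\<^bsub>G \<times>\<times> H\<^esub> (\<one>\<^bsub>G\<^esub>, b') \<in> K"
      by (rule subgroup.m_closed [OF K])
    then show "(a, b') \<in> K" using ab KG by (auto simp: DirProd_def)
  qed
qed force

text \<open>The inverse takes a subgroup to its two projections; coprimality enters only in
  recovering \<open>K\<close> as the product of them.\<close>

lemma bij_betw_subgroups_DirProd_coprime:
  assumes G: "group G" and H: "group H" and cop: "coprime (order G) (order H)"
  shows "bij_betw (\<lambda>(A, B). A \<times> B) ({A. subgroup A G} \<times> {B. subgroup B H})
           {K. subgroup K (G \<times>\<times> H)}"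
proof -
  interpret G: group G by fact
  interpret H: group H by fact
  interpret P: group "G \<times>\<times> H" by (rule DirProd_group) fact+
  have "fst \<in> hom (G \<times>\<times> H) G" "snd \<in> hom (G \<times>\<times> H) H"
    by (auto simp: hom_def DirProd_def)
  then have proj: "group_hom (G \<times>\<times> H) G fst" "group_hom (G \<times>\<times> H) H snd"
    by unfold_locales
  show ?thesis
  proof (rule bij_betw_byWitness [where f' = "\<lambda>K. (fst ` K, snd ` K)"])
    show "\<forall>x\<in>{A. subgroup A G} \<times> {B. subgroup B H}.
        (fst ` (case x of (A, B) \<Rightarrow> A \<times> B), snd ` (case x of (A, B) \<Rightarrow> A \<times> B)) = x"
      \<comment> \<open>Projecting \<open>A \<times> B\<close> gives back both factors because each
        contains the identity and so is nonempty.\<close>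
      by (auto simp: fst_image_times snd_image_times split: if_splits dest: subgroup.one_closed)
    show "\<forall>K\<in>{K. subgroup K (G \<times>\<times> H)}. (case (fst ` K, snd ` K) of (A, B) \<Rightarrow> A \<times> B) = K"
      using subgroup_DirProd_coprime [OF G H cop] by auto
    show "(\<lambda>(A, B). A \<times> B) ` ({A. subgroup A G} \<times> {B. subgroup B H}) \<subseteq> {K. subgroup K (G \<times>\<times> H)}"
      using DirProd_subgroups [OF G _ H] by auto
    show "(\<lambda>K. (fst ` K, snd ` K)) ` {K. subgroup K (G \<times>\<times> H)} \<subseteq>
        {A. subgroup A G} \<times> {B. subgroup B H}"
      using proj by (auto intro: group_hom.subgroup_img_is_subgroup)
  qed
qed

section \<open>Transport of subgroups along an isomorphism\<close>

lemma inj_on_image_subset_iff: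
  assumes "inj_on f S" "A \<subseteq> S" "B \<subseteq> S"
  shows "f ` A \<subseteq> f ` B \<longleftrightarrow> A \<subseteq> B"
proof -
  have "f x \<in> f ` B \<longleftrightarrow> x \<in> B" if "x \<in> A" for x
    using assms that by (intro inj_on_image_mem_iff) auto
  then show ?thesis by (simp add: image_subset_iff subset_eq)
qed

lemma bij_betw_subgroups_iso:
  assumes G: "group G" and H: "group H" and h: "h \<in> iso G H"
  shows "bij_betw ((`) h) {A. subgroup A G} {B. subgroup B H}"
proof -
  have bij: "bij_betw h (carrier G) (carrier H)" using h by (simp add: iso_def)
  have hom: "group_hom G H h"
    using G H h by (simp add: group_hom_def group_hom_axioms_def iso_def)
  have "inv_into (carrier G) h \<in> iso H G" using G h by (rule group.iso_set_sym)
  then have hom': "group_hom H G (inv_into (carrier G) h)"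
    using G H by (simp add: group_hom_def group_hom_axioms_def iso_def)
  show ?thesis
  proof (rule bij_betw_byWitness [where f' = "(`) (inv_into (carrier G) h)"])
    show "\<forall>A\<in>{A. subgroup A G}. inv_into (carrier G) h ` h ` A = A"
      using bij by (simp add: bij_betw_def subgroup.subset)
    show "\<forall>B\<in>{B. subgroup B H}. h ` inv_into (carrier G) h ` B = B"
      using bij image_inv_into_cancel [of h "carrier G" "carrier H"]
      by (simp add: bij_betw_def subgroup.subset)
    show "(`) h ` {A. subgroup A G} \<subseteq> {B. subgroup B H}"
      using group_hom.subgroup_img_is_subgroup [OF hom] by auto
    show "(`) (inv_into (carrier G) h) ` {B. subgroup B H} \<subseteq> {A. subgroup A G}"
      using group_hom.subgroup_img_is_subgroup [OF hom'] by auto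
  qed
qed

section \<open>The formula for the number of diamonds\<close>

theorem theorem2p1:
  fixes G :: "('a, 'm) monoid_scheme" and G1 :: "('b, 'n) monoid_scheme"
    and G2 :: "('c, 'k) monoid_scheme"
    and p1 p2 \<alpha>1 \<alpha>2 :: nat
  assumes "comm_group G" and "finite (carrier G)"
    and "group G1" and "group G2"
    and "G \<cong> G1 \<times>\<times> G2"
    and "Factorial_Ring.prime p1" and "Factorial_Ring.prime p2" and "p1 \<noteq> p2"
    and "order G1 = p1 ^ \<alpha>1" and "order G2 = p2 ^ \<alpha>2"
  shows "dm G = dm G1 * card (carrier (subgroup_lattice G2))
              + dm G2 * card (carrier (subgroup_lattice G1))
              + 6 * dm G1 * dm G2"
proof -
  interpret G: comm_group G by fact
  interpret G1: group G1 by fact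
  interpret G2: group G2 by fact
  interpret P: group "G1 \<times>\<times> G2" by (rule DirProd_group) fact+
  have fin: "finite (carrier G1)" "finite (carrier G2)"
    using assms by (simp_all flip: G1.order_gt_0_iff_finite G2.order_gt_0_iff_finite add: prime_gt_0_nat)
  have cop: "coprime (order G1) (order G2)"
    using assms by (simp add: primes_coprime)
  obtain h where h: "h \<in> iso (G1 \<times>\<times> G2) G"
    using assms(5) G.is_group P.is_group group.iso_sym unfolding is_iso_def by blast
  let ?L = "{H. subgroup H G}" and ?L1 = "{H. subgroup H G1}" and ?L2 = "{H. subgroup H G2}"
  \<comment> \<open>The order isomorphism from pairs of subgroups to subgroups of \<open>G\<close>:
    form the product, then transport it by \<open>h\<close>.\<close>
  define f where "f = (`) h \<circ> (\<lambda>(A, B). A \<times> B)"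
  have f: "bij_betw f (?L1 \<times> ?L2) ?L"
    unfolding f_def
    by (rule bij_betw_trans [OF bij_betw_subgroups_DirProd_coprime bij_betw_subgroups_iso])
      (fact cop h G1.is_group G2.is_group P.is_group G.is_group)+
  have le: "f (A, B) \<subseteq> f (A', B') \<longleftrightarrow> A \<subseteq> A' \<and> B \<subseteq> B'"
    if "A \<in> ?L1" "A' \<in> ?L1" "B \<in> ?L2" "B' \<in> ?L2" for A B A' B'
  proof -
    have "A \<times> B \<subseteq> carrier (G1 \<times>\<times> G2)" "A' \<times> B' \<subseteq> carrier (G1 \<times>\<times> G2)"
      using that by (auto simp: DirProd_def dest: subgroup.subset)
    moreover have "inj_on h (carrier (G1 \<times>\<times> G2))" using h by (simp add: iso_def bij_betw_def)
    ultimately have "h ` (A \<times> B) \<subseteq> h ` (A' \<times> B') \<longleftrightarrow> A \<times> B \<subseteq> A' \<times> B'"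
      by (intro inj_on_image_subset_iff)
    then have "f (A, B) \<subseteq> f (A', B') \<longleftrightarrow> A \<times> B \<subseteq> A' \<times> B'" by (simp add: f_def)
    \<comment> \<open>Inclusion of products is componentwise only for nonempty factors; subgroups
      contain the identity.\<close>
    also have "\<dots> \<longleftrightarrow> A \<subseteq> A' \<and> B \<subseteq> B'"
      using that by (auto simp: times_subset_iff dest: subgroup.one_closed)
    finally show ?thesis .
  qed
  \<comment> \<open>The trivial subgroups and the full carriers are the least and greatest members
    of the two families.\<close>
  have "card (balanced ?L) = card (balanced ?L1) * card (balanced ?L2)"
    by (rule card_balanced_product [OF f le, of "{\<one>\<^bsub>G1\<^esub>}" "{\<one>\<^bsub>G2\<^esub>}" "carrier G1" "carrier G2"])
      (auto simp: G1.triv_subgroup G2.triv_subgroup G1.subgroup_self G2.subgroup_self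
        dest: subgroup.one_closed subgroup.subset)
  moreover have "card ?L = card ?L1 * card ?L2"
    using bij_betw_same_card [OF f] by (simp add: card_cartesian_product)
  ultimately have "6 * dm G + card ?L1 * card ?L2 =
      (6 * dm G1 + card ?L1) * (6 * dm G2 + card ?L2)"
    using assms(2) fin
    by (simp add: G.card_balanced_subgroups G1.card_balanced_subgroups G2.card_balanced_subgroups)
  \<comment> \<open>After expansion the product of the two subgroup counts cancels, and a common
    factor 6 remains; the mixed term 36 leaves the coefficient 6.\<close>
  then show ?thesis by (simp add: algebra_simps)
qed

end
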